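(* Let $q$ be a positive even integer. Then there exists a real number $C=C(q)>1$ such that for every $\varepsilon\in(0,1)$ we have $$N_q^{\mathrm{int}}(\varepsilon,d)\ \ge\ C^d\,(1+o(1))\qquad\text{as } d\to\infty,$$ i.e. there is a sequence $(r_d)_{d\ge1}$ (possibly depending on $\varepsilon$) with $r_d\to0$ and $N_q^{\mathrm{int}}(\varepsilon,d)\ge C^d(1+r_d)$ for all $d$. In particular, the integration problem in $F_{d,q}$ suffers from the curse of dimensionality.
   Context: For $q\in[1,\infty)$, $W_q^{\boldsymbol 1}=W_q^{(1,\dots,1)}([0,1]^d)$ denotes the $d$-fold tensor product of the space of absolutely continuous functions on $[0,1]$ with first derivative in $L_q([0,1])$, i.e. functions on $[0,1]^d$ once differentiable in each variable whose mixed derivative $\frac{\partial^d f}{\partial\boldsymbol{x}}=\frac{\partial^d f}{\partial x_1\cdots\partial x_d}$ lies in $L_q$. Let $\|f\|_{d,q}=\left(\int_{[0,1]^d}\left|\frac{\partial^d f}{\partial\boldsymbol{x}}(\boldsymbol{x})\right|^q d\boldsymbol{x}\right)^{1/q}$ and $F_{d,q}=\{f\in W_q^{\boldsymbol 1}: f(\boldsymbol{x})=0 \text{ whenever } x_j=0 \text{ for some } j,\ \|f\|_{d,q}<\infty\}$. Let $I_d(f)=\int_{[0,1]^d}f(\boldsymbol{x})\,d\boldsymbol{x}$. An algorithm using $N$ function evaluations has the form $A_{d,N}(f)=\varphi(f(\boldsymbol{x}_1),\dots,f(\boldsymbol{x}_N))$ with arbitrary $\varphi:\mathbb{R}^N\to\mathbb{R}$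 satisfying $\varphi(0,\dots,0)=0$ and nodes $\boldsymbol{x}_1,\dots,\boldsymbol{x}_N\in[0,1)^d$. Its worst-case error is $e(F_{d,q},A_{d,N})=\sup_{f\in F_{d,q},\|f\|_{d,q}\le1}|I_d(f)-A_{d,N}(f)|$. The $N$-th minimal worst-case error $e_q(N,d)$ is the infimum of $e(F_{d,q},A_{d,N})$ over all such algorithms, and the initial error is $e_q(0,d)=\sup_{f\in F_{d,q},\|f\|_{d,q}\le1}|I_d(f)|$. The information complexity is $N_q^{\mathrm{int}}(\varepsilon,d)=\min\{N\in\mathbb{N}: e_q(N,d)\le\varepsilon\, e_q(0,d)\}$. *)

theory Defs
  imports "HOL-Analysis.Analysis" "HOL-Probability.Probability"
begin

definition cube_meas :: "nat \<Rightarrow> (nat \<Rightarrow> real) measure" where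
  "cube_meas d = PiM {..<d} (\<lambda>_. lborel)"

definition unit_cube :: "nat \<Rightarrow> (nat \<Rightarrow> real) set" where
  "unit_cube d = PiE {..<d} (\<lambda>_. {0..1})"

definition half_open_cube :: "nat \<Rightarrow> (nat \<Rightarrow> real) set" where
  "half_open_cube d = PiE {..<d} (\<lambda>_. {0..<1})"

definition anchored_box :: "nat \<Rightarrow> (nat \<Rightarrow> real) \<Rightarrow> (nat \<Rightarrow> real) set" where
  "anchored_box d x = PiE {..<d} (\<lambda>j. {0..x j})"

text \<open>Unit ball of F_{d,q}: functions f with f(x) = integral over [0,x] of g,
  where g (the mixed derivative of f) satisfies integral of |g|^q over [0,1]^d <= 1.
  Such f automatically vanish whenever some coordinate is 0.\<close>
definition F_ball :: "real \<Rightarrow> nat \<Rightarrow> ((nat \<Rightarrow> real) \<Rightarrow> real) set" where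
  "F_ball q d = {f. \<exists>g. g \<in> borel_measurable (cube_meas d) \<and>
       (\<integral>\<^sup>+ t \<in> unit_cube d. ennreal (\<bar>g t\<bar> powr q) \<partial>(cube_meas d)) \<le> 1 \<and>
       (\<forall>x \<in> unit_cube d. f x = (LINT t : anchored_box d x | cube_meas d. g t))}"

definition I_int :: "nat \<Rightarrow> ((nat \<Rightarrow> real) \<Rightarrow> real) \<Rightarrow> real" where
  "I_int d f = (LINT x : unit_cube d | cube_meas d. f x)"

definition wc_error :: "real \<Rightarrow> nat \<Rightarrow> (nat \<Rightarrow> real) list \<Rightarrow> (real list \<Rightarrow> real) \<Rightarrow> ereal" where
  "wc_error q d xs \<phi> = (SUP f \<in> F_ball q d. ereal \<bar>I_int d f - \<phi> (map f xs)\<bar>)"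

definition min_error :: "real \<Rightarrow> nat \<Rightarrow> nat \<Rightarrow> ereal" where
  "min_error q N d = (INF (xs, \<phi>) \<in> {(xs, \<phi>). length xs = N \<and> set xs \<subseteq> half_open_cube d
       \<and> \<phi> (replicate N 0) = 0}. wc_error q d xs \<phi>)"

definition init_error :: "real \<Rightarrow> nat \<Rightarrow> ereal" where
  "init_error q d = (SUP f \<in> F_ball q d. ereal \<bar>I_int d f\<bar>)"

definition N_int :: "real \<Rightarrow> real \<Rightarrow> nat \<Rightarrow> nat" where
  "N_int q \<epsilon> d = (LEAST N. min_error q N d \<le> ereal \<epsilon> * init_error q d)"

end

theory Submission
  imports Defs
begin

text \<open>
  By Fubini, \<open>I(f)\<close> is the pairing of the mixed derivative \<open>g\<close> of \<open>f\<close> with \<open>\<Prod>\<^sub>j (1 - t\<^sub>j)\<close>; the extremal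
  derivative is therefore the tensor power of \<open>g\<^sub>0(t) = (1 - t) powr (1 / (q - 1))\<close>. Split
  \<open>g\<^sub>0 = u + v + w\<close>, where \<open>v\<close> and \<open>w\<close> are small mean-zero two-step functions supported in \<open>[0, 1/2]\<close>
  and \<open>[1/2, 1]\<close>, positive before negative. Since \<open>g\<^sub>0\<close> decreases strictly, all mixed moments
  \<open>\<integral> u^k v^m w^n\<close> are nonnegative. Expand the tensor power into \<open>3^d\<close> words over \<open>{u, v, w}\<close> and keep
  only the words whose antiderivative vanishes at all nodes. As \<open>q\<close> is even, the \<open>q\<close>-th power of the
  norm is a sum of products of mixed moments, so it does not increase. At each node and in each
  coordinate the antiderivative of \<open>v\<close> or of \<open>w\<close> vanishes, hence a node removes at most the fraction
  \<open>\<theta>^d\<close> of the integral for some \<open>\<theta> < 1\<close>, and \<open>N \<ge> (1 - \<epsilon>) \<theta>^(-d)\<close> nodes are needed. The convergence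
  of a grid rule guarantees that the minimum defining \<open>N_int\<close> is over a nonempty set.
\<close>

subsection \<open>Integration over the cube\<close>

lemma cube_meas_product: "product_sigma_finite (\<lambda>_. lborel :: real measure)"
  by standard

lemma cube_meas_sigma_finite: "sigma_finite_measure (cube_meas d)"
  unfolding cube_meas_def using product_sigma_finite.sigma_finite[OF cube_meas_product] by blast

lemma space_cube_meas: "space (cube_meas d) = PiE {..<d} (\<lambda>_. UNIV)"
  by (simp add: cube_meas_def space_PiM)

lemma measurable_coord [measurable]:
  "j < d \<Longrightarrow> (\<lambda>x. x j) \<in> borel_measurable (cube_meas d)"
  unfolding cube_meas_def by (rule measurable_PiM_component_rev[of j]) auto

text \<open>Points of the space are extensional, so a point outside the box must fail in one of the
  first \<open>d\<close> coordinates.\<close>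

lemma indicator_PiE_prod:
  assumes "x \<in> space (cube_meas d)"
  shows "indicator (PiE {..<d} A) x = (\<Prod>j<d. indicator (A j) (x j) :: real)"
proof (cases "x \<in> PiE {..<d} A")
  case True
  then show ?thesis by (auto simp: PiE_iff)
next
  case False
  with assms obtain j where "j < d" "x j \<notin> A j"
    by (auto simp: space_cube_meas PiE_iff)
  then have "(\<Prod>j<d. indicator (A j) (x j) :: real) = 0"
    by (intro prod_zero bexI[of _ j]) auto
  with False show ?thesis by simp
qed

lemma sets_PiE_cube [measurable]:
  "(\<And>j. j < d \<Longrightarrow> A j \<in> sets borel) \<Longrightarrow> PiE {..<d} A \<in> sets (cube_meas d)"
  unfolding cube_meas_def by (intro sets_PiM_I_finite) auto

lemma unit_cube_sets [measurable]: "unit_cube d \<in> sets (cube_meas d)"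
  unfolding unit_cube_def by (rule sets_PiE_cube) auto

lemma anchored_box_sets [measurable]: "anchored_box d x \<in> sets (cube_meas d)"
  unfolding anchored_box_def by (rule sets_PiE_cube) auto

lemma integrable_cube_prod:
  fixes h :: "nat \<Rightarrow> real \<Rightarrow> real"
  assumes "\<And>j. j < d \<Longrightarrow> integrable lborel (h j)"
  shows "integrable (cube_meas d) (\<lambda>x. \<Prod>j<d. h j (x j))"
  unfolding cube_meas_def using assms
  by (intro product_sigma_finite.product_integrable_prod[OF cube_meas_product]) auto

lemma integral_cube_prod:
  fixes h :: "nat \<Rightarrow> real \<Rightarrow> real"
  assumes "\<And>j. j < d \<Longrightarrow> integrable lborel (h j)"
  shows "integral\<^sup>L (cube_meas d) (\<lambda>x. \<Prod>j<d. h j (x j)) = (\<Prod>j<d. integral\<^sup>L lborel (h j))"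
  unfolding cube_meas_def using assms
  by (intro product_sigma_finite.product_integral_prod[OF cube_meas_product]) auto

lemma emeasure_unit_cube: "emeasure (cube_meas d) (unit_cube d) = 1"
  unfolding cube_meas_def unit_cube_def
  by (subst product_sigma_finite.emeasure_PiM[OF cube_meas_product]) auto

text \<open>For fixed \<open>t\<close> the kernel is, in \<open>x\<close>, the indicator of
  \<open>{t..1}\<close>; its length is the factor \<open>1 - t\<close> of the integration
  functional.\<close>

lemma integral_upper_kernel:
  fixes t :: real
  shows "integrable lborel (\<lambda>x. indicator {0..1} x * indicator {0..x} t :: real)"
    and "(\<integral>x. indicator {0..1} x * indicator {0..x} t \<partial>lborel) = indicator {0..1} t * (1 - t)"
proof -
  have eq: "(\<lambda>x. indicator {0..1} x * indicator {0..x} t :: real)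
      = (\<lambda>x. indicator {0..1} t * indicator {t..1} x)"
    by (auto simp: indicator_def fun_eq_iff)
  show "integrable lborel (\<lambda>x. indicator {0..1} x * indicator {0..x} t :: real)"
    unfolding eq by (auto intro!: integrable_real_indicator simp: emeasure_lborel_Icc_eq)
  show "(\<integral>x. indicator {0..1} x * indicator {0..x} t \<partial>lborel) = indicator {0..1} t * (1 - t)"
    unfolding eq by (cases "t \<in> {0..1}") auto
qed

text \<open>Fubini for the box indicator times \<open>g\<close>: after the swap, the inner integral
  over \<open>x\<close> factorises over the coordinates.\<close>

lemma I_int_eq_kernel_integral:
  assumes g [measurable]: "g \<in> borel_measurable (cube_meas d)"
    and int: "set_integrable (cube_meas d) (unit_cube d) g"
    and f: "\<And>x. x \<in> unit_cube d \<Longrightarrow> f x = (LINT t : anchored_box d x | cube_meas d. g t)"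
  shows "I_int d f = (LINT t : unit_cube d | cube_meas d. g t * (\<Prod>j<d. 1 - t j))"
proof -
  let ?M = "cube_meas d"
  interpret sigma_finite_measure ?M by (rule cube_meas_sigma_finite)
  interpret P: pair_sigma_finite ?M ?M ..
  define k where "k = (\<lambda>x t :: real. indicator {0..1} x * indicator {0..x} t :: real)"
  define K where "K x t = (\<Prod>j<d. k (x j) (t j))" for x t
  \<comment> \<open>Written with comparisons, \<open>k\<close> is seen to be jointly measurable
    although the interval \<open>{0..x}\<close> varies with \<open>x\<close>.\<close>
  have k_eq: "k x t = (if 0 \<le> x \<and> x \<le> 1 \<and> 0 \<le> t \<and> t \<le> x then 1 else 0)" for x t
    by (auto simp: k_def indicator_def)
  have k_bd: "\<bar>k x t\<bar> \<le> indicator {0..1} x * indicator {0..1} t" for x t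
    by (auto simp: k_def indicator_def)
  have K_box: "K x t = indicator (unit_cube d) x * indicator (anchored_box d x) t"
    if "x \<in> space ?M" "t \<in> space ?M" for x t
    using that unfolding K_def k_def unit_cube_def anchored_box_def
    by (simp add: indicator_PiE_prod prod.distrib)
  have K_bd: "\<bar>K x t\<bar> \<le> indicator (unit_cube d) x * indicator (unit_cube d) t"
    if "x \<in> space ?M" "t \<in> space ?M" for x t
    using that unfolding K_def unit_cube_def abs_prod
    by (simp add: indicator_PiE_prod flip: prod.distrib) (intro prod_mono conjI k_bd, auto)
  have [measurable]: "(\<lambda>p. K (fst p) (snd p)) \<in> borel_measurable (?M \<Otimes>\<^sub>M ?M)"
    unfolding K_def k_eq by (intro borel_measurable_prod) measurable
  \<comment> \<open>A product majorant for \<open>K x t * g t\<close>, integrable because the cube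
    has measure 1.\<close>
  have dom: "integrable (?M \<Otimes>\<^sub>M ?M)
      (\<lambda>p. indicator (unit_cube d) (fst p) * (indicator (unit_cube d) (snd p) * g (snd p)))"
  proof (rule P.Fubini_integrable)
    have "integrable ?M (\<lambda>x. indicator (unit_cube d) x *
        (\<integral>t. norm (indicator (unit_cube d) t * g t) \<partial>?M))"
      using emeasure_unit_cube[of d] by (intro integrable_mult_left) auto
    then show "integrable ?M (\<lambda>x. \<integral>t. norm (indicator (unit_cube d) (fst (x, t)) *
        (indicator (unit_cube d) (snd (x, t)) * g (snd (x, t)))) \<partial>?M)"
      by (simp add: abs_mult)
    show "AE x in ?M. integrable ?M (\<lambda>t. indicator (unit_cube d) (fst (x, t)) *
        (indicator (unit_cube d) (snd (x, t)) * g (snd (x, t))))"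
      using int by (auto simp: set_integrable_def)
  qed measurable
  have "integrable (?M \<Otimes>\<^sub>M ?M) (\<lambda>p. K (fst p) (snd p) * g (snd p))"
    by (rule Bochner_Integration.integrable_bound[OF dom])
       (auto simp: abs_mult space_pair_measure
          intro!: AE_I2 order_trans[OF mult_right_mono[OF K_bd abs_ge_zero]])
  then have int2: "integrable (?M \<Otimes>\<^sub>M ?M) (\<lambda>(x, t). K x t * g t)"
    by (simp add: case_prod_unfold)
  have "I_int d f = (\<integral>x. (\<integral>t. K x t * g t \<partial>?M) \<partial>?M)"
    unfolding I_int_def set_lebesgue_integral_def
  proof (rule Bochner_Integration.integral_cong)
    fix x assume x: "x \<in> space ?M"
    have "(\<integral>t. K x t * g t \<partial>?M)
        = (\<integral>t. indicator (unit_cube d) x * (indicator (anchored_box d x) t * g t) \<partial>?M)"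
      by (rule Bochner_Integration.integral_cong) (simp_all add: K_box x)
    then show "indicator (unit_cube d) x *\<^sub>R f x = (\<integral>t. K x t * g t \<partial>?M)"
      by (auto simp: f set_lebesgue_integral_def indicator_def)
  qed simp
  also have "\<dots> = (\<integral>t. (\<integral>x. K x t * g t \<partial>?M) \<partial>?M)"
    using P.Fubini_integral[OF int2] by simp
  also have "\<dots> = (LINT t : unit_cube d | cube_meas d. g t * (\<Prod>j<d. 1 - t j))"
    unfolding set_lebesgue_integral_def
  proof (rule Bochner_Integration.integral_cong)
    fix t assume t: "t \<in> space ?M"
    have "(\<integral>x. K x t \<partial>?M) = (\<Prod>j<d. indicator {0..1} (t j) * (1 - t j))"
      unfolding K_def k_def
      by (subst integral_cube_prod) (simp_all add: integral_upper_kernel)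
    then show "(\<integral>x. K x t * g t \<partial>?M) = indicator (unit_cube d) t *\<^sub>R (g t * (\<Prod>j<d. 1 - t j))"
      using t by (simp add: unit_cube_def indicator_PiE_prod prod.distrib)
  qed simp
  finally show ?thesis .
qed

subsection \<open>Convergence of the grid rule\<close>

text \<open>From \<open>\<bar>g\<bar> \<le> 1 + \<bar>g\<bar> powr q\<close> on a cube of measure 1;
  the resulting bound 2 is cruder than Hoelder's inequality but suffices for convergence.\<close>

lemma F_ball_integrable:
  assumes q: "q \<ge> 1"
    and g [measurable]: "g \<in> borel_measurable (cube_meas d)"
    and le1: "(\<integral>\<^sup>+ t \<in> unit_cube d. ennreal (\<bar>g t\<bar> powr q) \<partial>(cube_meas d)) \<le> 1"
  shows "set_integrable (cube_meas d) (unit_cube d) (\<lambda>t. \<bar>g t\<bar> powr q)"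
    and "set_integrable (cube_meas d) (unit_cube d) g"
    and "(LINT t : unit_cube d | cube_meas d. \<bar>g t\<bar> powr q) \<le> 1"
    and "(LINT t : unit_cube d | cube_meas d. \<bar>g t\<bar>) \<le> 2"
proof -
  let ?M = "cube_meas d"
  have nn: "(\<integral>\<^sup>+ t. ennreal (indicator (unit_cube d) t * \<bar>g t\<bar> powr q) \<partial>?M) \<le> 1"
    using le1 by (simp add: ennreal_mult' ennreal_indicator mult.commute)
  show int: "set_integrable ?M (unit_cube d) (\<lambda>t. \<bar>g t\<bar> powr q)"
    unfolding set_integrable_def
    using nn by (intro integrableI_nonneg) (auto simp: less_top[symmetric] top_unique)
  have one: "set_integrable ?M (unit_cube d) (\<lambda>_. 1 :: real)"
    using emeasure_unit_cube[of d] by (simp add: set_integrable_def)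
  have bd: "\<bar>g t\<bar> \<le> 1 + \<bar>g t\<bar> powr q" for t
  proof (cases "\<bar>g t\<bar> \<le> 1")
    case False
    then have "\<bar>g t\<bar> powr 1 \<le> \<bar>g t\<bar> powr q" using q by (intro powr_mono) auto
    with False show ?thesis by simp
  qed (simp add: add_increasing2)
  have sum_int: "set_integrable ?M (unit_cube d) (\<lambda>t. 1 + \<bar>g t\<bar> powr q)"
    using one int by simp
  show gi: "set_integrable ?M (unit_cube d) g"
    by (rule set_integrable_bound[OF sum_int])
       (auto simp: set_borel_measurable_def intro!: AE_I2 order_trans[OF bd])
  show le: "(LINT t : unit_cube d | ?M. \<bar>g t\<bar> powr q) \<le> 1"
    unfolding set_lebesgue_integral_def
    using nn by (subst integral_eq_nn_integral) (auto simp: enn2real_leI)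
  have "(LINT t : unit_cube d | ?M. \<bar>g t\<bar>) \<le> (LINT t : unit_cube d | ?M. 1 + \<bar>g t\<bar> powr q)"
    using gi by (intro set_integral_mono sum_int bd) (rule set_integrable_abs)
  also have "\<dots> = (LINT t : unit_cube d | ?M. 1) + (LINT t : unit_cube d | ?M. \<bar>g t\<bar> powr q)"
    by (rule set_integral_add(2)[OF one int])
  also have "(LINT t : unit_cube d | ?M. 1 :: real) = 1"
    using emeasure_unit_cube[of d] by (simp add: set_lebesgue_integral_def measure_def)
  finally show "(LINT t : unit_cube d | ?M. \<bar>g t\<bar>) \<le> 2" using le by simp
qed

text \<open>A grid point \<open>k / n\<close> is at least \<open>t\<close> iff \<open>k\<close> is
  at least the ceiling of \<open>n * t\<close>. Divided by \<open>n\<close>, the count approximates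
  \<open>1 - t\<close> within \<open>1 / n\<close>.\<close>

lemma grid_tail_average:
  fixes t :: real
  assumes "n > 0" "0 \<le> t" "t \<le> 1"
  shows "(\<Sum>k<n. indicator {0..real k / real n} t) = real n - of_int \<lceil>real n * t\<rceil>"
proof -
  have "0 \<le> real n * t" "real n * t \<le> real n"
    using assms by (simp, intro mult_left_le) auto
  then have c: "0 \<le> \<lceil>real n * t\<rceil>" "\<lceil>real n * t\<rceil> \<le> int n"
    by linarith+
  have "(\<Sum>k<n. indicator {0..real k / real n} t :: real)
      = (\<Sum>k\<in>{nat \<lceil>real n * t\<rceil>..<n}. 1)"
  proof (rule sum.mono_neutral_cong_right)
    have "t \<le> real k / real n \<longleftrightarrow> nat \<lceil>real n * t\<rceil> \<le> k" for k
      using assms(1) c by (simp add: field_simps nat_le_iff ceiling_le_iff)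
    then show "\<forall>i\<in>{..<n} - {nat \<lceil>real n * t\<rceil>..<n}. indicator {0..real i / real n} t = (0::real)"
      "\<And>i. i \<in> {nat \<lceil>real n * t\<rceil>..<n} \<Longrightarrow> indicator {0..real i / real n} t = (1::real)"
      using assms by auto
  qed auto
  also have "\<dots> = real n - of_int \<lceil>real n * t\<rceil>"
    using c by (simp add: of_nat_diff nat_le_iff)
  finally show ?thesis .
qed

text \<open>Makes the set under \<open>LEAST\<close> in \<open>N_int\<close> nonempty. The
  left-endpoint product rule pairs \<open>g\<close> with a product of step functions close to the
  factors \<open>1 - t j\<close>.\<close>

lemma min_error_arbitrarily_small:
  assumes q: "q \<ge> 1" and e: "e > 0"
  shows "\<exists>N. min_error q N d \<le> ereal e"
proof -
  let ?M = "cube_meas d"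
  \<comment> \<open>Ensures \<open>2 * (d / n) \<le> e\<close>: 2 bounds the integral of
    \<open>\<bar>g\<bar>\<close>, and \<open>d / n\<close> the kernel deviation.\<close>
  obtain n :: nat where n: "n > 0" "2 * real d / e < real n"
    by (metis gr0I less_trans of_nat_0_less_iff reals_Archimedean2 not_less of_nat_0 
        divide_nonneg_pos e mult_nonneg_nonneg of_nat_0_le_iff zero_le_numeral)
  \<comment> \<open>The endpoint 1 is omitted because nodes must lie in the half-open cube.\<close>
  define G where "G = (\<lambda>k. real k / real n) ` {..<n}"
  define X where "X = PiE {..<d} (\<lambda>_. G)"
  define S where "S t = (\<Sum>y\<in>G. indicator {0..y} t :: real)" for t
  have G: "finite G" "G \<subseteq> {0..<1}"
    using n by (auto simp: G_def)
  have X: "finite X" "X \<subseteq> half_open_cube d"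
    unfolding X_def half_open_cube_def using G by (auto intro!: finite_PiE)
  have S_eq: "S t = (\<Sum>k<n. indicator {0..real k / real n} t)" for t
    unfolding S_def G_def using n by (subst sum.reindex) (auto simp: inj_on_def)
  have S_close: "\<bar>(1 - t) - S t / real n\<bar> \<le> 1 / real n" "\<bar>S t / real n\<bar> \<le> 1"
    if "0 \<le> t" "t \<le> 1" for t
  proof -
    define a where "a = real_of_int \<lceil>real n * t\<rceil>"
    have "S t = real n - a"
      unfolding S_eq a_def using n that by (intro grid_tail_average)
    then have eq: "(1 - t) - S t / real n = (a - real n * t) / real n"
      using n by (simp add: field_simps)
    have "\<bar>a - real n * t\<bar> \<le> 1"
      unfolding a_def by linarith
    then show "\<bar>(1 - t) - S t / real n\<bar> \<le> 1 / real n"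
      unfolding eq abs_divide by (simp add: divide_right_mono)
    have "0 \<le> S t" unfolding S_eq by (intro sum_nonneg) auto
    moreover have "S t \<le> (\<Sum>k<n. 1)" unfolding S_eq by (intro sum_mono) (auto simp: indicator_def)
    ultimately show "\<bar>S t / real n\<bar> \<le> 1"
      using n by simp
  qed
  have [measurable]: "S \<in> borel_measurable borel" unfolding S_def by measurable
  obtain xs where xs: "set xs = X" "distinct xs"
    using finite_distinct_list[OF X(1)] by auto
  define \<phi> where "\<phi> ys = sum_list ys / real n ^ d" for ys
  have err: "\<bar>I_int d f - \<phi> (map f xs)\<bar> \<le> e" if "f \<in> F_ball q d" for f
  proof -
    from that obtain g where g [measurable]: "g \<in> borel_measurable ?M"
      and le1: "(\<integral>\<^sup>+ t \<in> unit_cube d. ennreal (\<bar>g t\<bar> powr q) \<partial>?M) \<le> 1"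
      and f: "\<And>x. x \<in> unit_cube d \<Longrightarrow> f x = (LINT t : anchored_box d x | ?M. g t)"
      unfolding F_ball_def by blast
    note gi = F_ball_integrable[OF q g le1]
    have Xc: "x \<in> unit_cube d" if "x \<in> X" for x
      using that X(2) by (force simp: half_open_cube_def unit_cube_def PiE_iff)
    have box_sub: "anchored_box d x \<subseteq> unit_cube d" if "x \<in> X" for x
      using Xc[OF that] by (force simp: anchored_box_def unit_cube_def PiE_iff)
    \<comment> \<open>Distributivity over the product grid turns the rule into a pairing of
      \<open>g\<close> with a product kernel.\<close>
    have weight: "(\<Sum>x\<in>X. indicator (anchored_box d x) t) = indicator (unit_cube d) t * (\<Prod>j<d. S (t j))"
      if t: "t \<in> space ?M" for t
    proof (cases "t \<in> unit_cube d")
      case True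
      have "(\<Prod>j<d. S (t j)) = (\<Sum>x\<in>X. \<Prod>j<d. indicator {0..x j} (t j))"
        unfolding S_def X_def by (rule prod_sum_PiE) (auto simp: G)
      with True show ?thesis
        using t by (simp add: anchored_box_def indicator_PiE_prod)
    next
      case False
      then have "indicator (anchored_box d x) t = (0::real)" if "x \<in> X" for x
        using box_sub[OF that] by (auto simp: indicator_def)
      with False show ?thesis by simp
    qed
    have "sum_list (map f xs) = (\<Sum>x\<in>X. f x)"
      using xs by (simp add: sum_list_distinct_conv_sum_set)
    also have "\<dots> = (\<Sum>x\<in>X. \<integral>t. indicator (anchored_box d x) t * g t \<partial>?M)"
      using f Xc by (intro sum.cong) (auto simp: set_lebesgue_integral_def)
    also have "\<dots> = (\<integral>t. (\<Sum>x\<in>X. indicator (anchored_box d x) t * g t) \<partial>?M)"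
    proof (rule Bochner_Integration.integral_sum[symmetric])
      fix x assume "x \<in> X"
      then have "set_integrable ?M (anchored_box d x) g"
        by (intro set_integrable_subset[OF gi(2)] box_sub) auto
      then show "integrable ?M (\<lambda>t. indicator (anchored_box d x) t * g t)"
        by (simp add: set_integrable_def)
    qed
    also have "\<dots> = (LINT t : unit_cube d | ?M. g t * (\<Prod>j<d. S (t j)))"
      unfolding set_lebesgue_integral_def
      by (rule Bochner_Integration.integral_cong) (auto simp: weight simp flip: sum_distrib_right)
    finally have \<phi>_eq: "\<phi> (map f xs) = (LINT t : unit_cube d | ?M. g t * (\<Prod>j<d. S (t j) / real n))"
      by (simp add: \<phi>_def prod_dividef flip: set_integral_divide_zero)
    have I_eq: "I_int d f = (LINT t : unit_cube d | ?M. g t * (\<Prod>j<d. 1 - t j))"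
      by (rule I_int_eq_kernel_integral[OF g gi(2) f])
    have bdd: "set_integrable ?M (unit_cube d) (\<lambda>t. g t * (\<Prod>j<d. h (t j)))"
      if [measurable]: "h \<in> borel_measurable borel" and h: "\<And>s. 0 \<le> s \<Longrightarrow> s \<le> 1 \<Longrightarrow> \<bar>h s\<bar> \<le> 1" for h
    proof (rule set_integrable_bound[OF gi(2)])
      show "AE t in ?M. t \<in> unit_cube d \<longrightarrow> norm (g t * (\<Prod>j<d. h (t j))) \<le> norm (g t)"
      proof (intro AE_I2 impI)
        fix t assume "t \<in> unit_cube d"
        then have "(\<Prod>j<d. \<bar>h (t j)\<bar>) \<le> 1"
          by (intro prod_le_1) (auto simp: unit_cube_def PiE_iff h)
        then show "norm (g t * (\<Prod>j<d. h (t j))) \<le> norm (g t)"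
          by (simp add: abs_mult abs_prod mult_left_le)
      qed
    qed (auto simp: set_borel_measurable_def)
    have int1: "set_integrable ?M (unit_cube d) (\<lambda>t. g t * (\<Prod>j<d. 1 - t j))"
      by (rule bdd[of "\<lambda>s. 1 - s"]) auto
    have int2: "set_integrable ?M (unit_cube d) (\<lambda>t. g t * (\<Prod>j<d. S (t j) / real n))"
      by (rule bdd[of "\<lambda>s. S s / real n"]) (use S_close(2) in \<open>simp, blast\<close>)
    have "\<bar>I_int d f - \<phi> (map f xs)\<bar>
        = \<bar>LINT t : unit_cube d | ?M. g t * (\<Prod>j<d. 1 - t j) - g t * (\<Prod>j<d. S (t j) / real n)\<bar>"
      unfolding I_eq \<phi>_eq by (simp add: set_integral_diff(2)[OF int1 int2])
    also have "\<dots> \<le> (LINT t : unit_cube d | ?M. \<bar>g t\<bar> * (real d / real n))"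
      unfolding set_lebesgue_integral_def
    proof (rule order_trans[OF integral_abs_bound integral_mono])
      show "integrable ?M (\<lambda>t. \<bar>indicator (unit_cube d) t *\<^sub>R
          (g t * (\<Prod>j<d. 1 - t j) - g t * (\<Prod>j<d. S (t j) / real n))\<bar>)"
        using set_integral_diff(1)[OF int1 int2] unfolding set_integrable_def
        by (rule integrable_abs)
      show "integrable ?M (\<lambda>t. indicator (unit_cube d) t *\<^sub>R (\<bar>g t\<bar> * (real d / real n)))"
        using set_integrable_abs[OF gi(2)] by (auto simp: set_integrable_def simp flip: mult.assoc)
      fix t assume "t \<in> space ?M"
      show "\<bar>indicator (unit_cube d) t *\<^sub>R
          (g t * (\<Prod>j<d. 1 - t j) - g t * (\<Prod>j<d. S (t j) / real n))\<bar>
        \<le> indicator (unit_cube d) t *\<^sub>R (\<bar>g t\<bar> * (real d / real n))"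
      proof (cases "t \<in> unit_cube d")
        case True
        then have tj: "0 \<le> t j" "t j \<le> 1" if "j < d" for j
          using that by (auto simp: unit_cube_def PiE_iff)
        \<comment> \<open>All factors are at most 1 in absolute value, so telescoping bounds the
          difference of products by the sum of differences.\<close>
        have "norm ((\<Prod>j<d. 1 - t j) - (\<Prod>j<d. S (t j) / real n))
            \<le> (\<Sum>j<d. norm ((1 - t j) - S (t j) / real n))"
          using tj S_close(2) by (intro norm_prod_diff) (simp, metis lessThan_iff real_norm_def)
        also have "\<dots> \<le> (\<Sum>j<d. 1 / real n)"
          using tj S_close(1) by (intro sum_mono) auto
        finally have "\<bar>g t\<bar> * \<bar>(\<Prod>j<d. 1 - t j) - (\<Prod>j<d. S (t j) / real n)\<bar>
            \<le> \<bar>g t\<bar> * (real d / real n)"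
          by (intro mult_left_mono) auto
        with True show ?thesis
          by (simp add: abs_mult flip: right_diff_distrib)
      qed simp
    qed
    also have "\<dots> = (LINT t : unit_cube d | ?M. \<bar>g t\<bar>) * (real d / real n)"
      by (rule set_integral_mult_left)
    also have "\<dots> \<le> 2 * (real d / real n)"
      by (intro mult_right_mono gi(4)) auto
    also have "\<dots> \<le> e"
      using n e by (simp add: field_simps)
    finally show ?thesis .
  qed
  have "wc_error q d xs \<phi> \<le> ereal e"
    unfolding wc_error_def using err by (intro SUP_least) auto
  moreover have "min_error q (length xs) d \<le> wc_error q d xs \<phi>"
    unfolding min_error_def using xs X
    by (intro INF_lower2[of "(xs, \<phi>)"]) (auto simp: \<phi>_def sum_list_replicate)
  ultimately show ?thesis by (meson order_trans)
qed

subsection \<open>The univariate decomposition\<close>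

text \<open>The equality case of Hoelder's inequality against \<open>1 - t\<close>; with
  \<open>root\<close>, the natural power \<open>q - 1\<close> gives the kernel back.\<close>

definition g0 :: "nat \<Rightarrow> real \<Rightarrow> real" where
  "g0 q t = indicator {0..1} t * root (q - 1) (1 - t)"

text \<open>The gap between the two steps leaves room for the decrease of \<open>g0\<close> to outweigh \<open>2 c\<close>.\<close>
definition bump :: "real \<Rightarrow> real \<Rightarrow> real \<Rightarrow> real" where
  "bump c a t = c * (indicator {a..<a+1/6} t - indicator {a+1/3..<a+1/2} t)"

text \<open>Indices 0, 1, 2 stand for \<open>u\<close>, \<open>v\<close>, \<open>w\<close>.\<close>
definition piece :: "nat \<Rightarrow> real \<Rightarrow> nat \<Rightarrow> real \<Rightarrow> real" where
  "piece q c k t = (if k = 0 then g0 q t - bump c 0 t - bump c (1/2) t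
     else if k = 1 then bump c 0 t else bump c (1/2) t)"

lemma g0_measurable [measurable]: "g0 q \<in> borel_measurable borel"
proof -
  have "(\<lambda>t. root (q - 1) (1 - t)) \<in> borel_measurable borel"
    by (intro borel_measurable_continuous_onI continuous_intros)
  then show ?thesis unfolding g0_def by measurable
qed

lemma bump_measurable [measurable]: "bump c a \<in> borel_measurable borel"
  unfolding bump_def by measurable

lemma piece_measurable [measurable]: "piece q c k \<in> borel_measurable borel"
  unfolding piece_def by measurable

lemma g0_nonneg: "0 \<le> g0 q t"
  by (auto simp: g0_def indicator_def intro: real_root_ge_zero)

lemma g0_le_1: "q \<ge> 2 \<Longrightarrow> g0 q t \<le> 1"
  by (auto simp: g0_def indicator_def)

lemma g0_antimono: "q \<ge> 2 \<Longrightarrow> 0 \<le> s \<Longrightarrow> s \<le> t \<Longrightarrow> t \<le> 1 \<Longrightarrow> g0 q t \<le> g0 q s"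
  by (auto simp: g0_def)

lemma g0_power: "q \<ge> 2 \<Longrightarrow> g0 q t ^ (q - 1) = indicator {0..1} t * (1 - t)"
  by (auto simp: g0_def indicator_def real_root_pow_pos2)

lemma g0_outside: "t \<notin> {0..1} \<Longrightarrow> g0 q t = 0"
  by (simp add: g0_def)

section \<open>Integrals of functions supported on intervals\<close>

lemma integrable_unit_interval:
  fixes f :: "real \<Rightarrow> real"
  assumes [measurable]: "f \<in> borel_measurable borel"
    and "\<And>t. t \<in> {0..1} \<Longrightarrow> \<bar>f t\<bar> \<le> B" and "\<And>t. t \<notin> {0..1} \<Longrightarrow> f t = 0"
  shows "integrable lborel f"
proof (rule Bochner_Integration.integrable_bound)
  show "integrable lborel (\<lambda>t :: real. B * indicator {0..1} t :: real)"
    by (intro integrable_mult_right integrable_real_indicator) (auto simp: emeasure_lborel_Icc_eq)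
  show "AE t in lborel. norm (f t) \<le> norm (B * indicator {0..1} t :: real)"
  proof (rule AE_I2)
    fix t show "norm (f t) \<le> norm (B * indicator {0..1} t :: real)"
      using assms(2,3)[of t] by (cases "t \<in> {0..1}") auto
  qed
qed simp

lemma integral_indicator_Ico:
  fixes a b :: real
  assumes "a \<le> b"
  shows "integrable lborel (indicator {a..<b} :: real \<Rightarrow> real)"
    and "(\<integral>t. indicator {a..<b} t \<partial>lborel) = b - a"
  using assms by (auto simp: integrable_indicator_iff)

lemma integral_linear_Ico:
  fixes a b :: real
  assumes "a \<le> b"
  shows "integrable lborel (\<lambda>t. indicator {a..<b} t * (1 - t))"
    and "(\<integral>t. indicator {a..<b} t * (1 - t) \<partial>lborel) = (b - a) - (b\<^sup>2 - a\<^sup>2) / 2"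
proof -
  \<comment> \<open>The fundamental theorem is applied on the closed interval, which differs by the
    null set \<open>{b}\<close>.\<close>
  have eq: "AE t in lborel. indicator {a..b} t * (1 - t) = indicator {a..<b} t * (1 - t)"
    using AE_lborel_singleton[of b] by eventually_elim (auto simp: indicator_def)
  have F: "((\<lambda>t. t - t\<^sup>2 / 2) has_real_derivative (1 - t)) (at t)" for t :: real
    by (auto intro!: derivative_eq_intros)
  have bd: "integrable lborel (\<lambda>t. indicator {a..b} t * (1 - t))"
    "(\<integral>t. indicator {a..b} t * (1 - t) \<partial>lborel) = (b - b\<^sup>2 / 2) - (a - a\<^sup>2 / 2)"
    using has_bochner_integral_FTC_Icc_real[OF assms F]
    by (simp_all add: has_bochner_integral_iff mult.commute)
  show "integrable lborel (\<lambda>t. indicator {a..<b} t * (1 - t))"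
    using integrable_cong_AE[THEN iffD1, OF _ _ eq bd(1)] by simp
  show "(\<integral>t. indicator {a..<b} t * (1 - t) \<partial>lborel) = (b - a) - (b\<^sup>2 - a\<^sup>2) / 2"
    using integral_cong_AE[OF _ _ eq] bd(2) by (simp add: diff_divide_distrib)
qed

text \<open>With \<open>u = g0 - c\<close> on positive and \<open>u = g0 + c\<close> on negative
  steps, this says that \<open>u\<close> on the positive step of each bump still dominates
  \<open>u\<close> on its negative step.\<close>

definition good_height :: "nat \<Rightarrow> real \<Rightarrow> bool" where
  "good_height q c \<longleftrightarrow> c > 0 \<and> g0 q (1/3) + c \<le> g0 q (1/6) - c \<and> g0 q (5/6) + c \<le> g0 q (2/3) - c"

lemma good_height_exists:
  assumes "q \<ge> 2"
  shows "\<exists>c. good_height q c"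
proof -
  let ?x = "g0 q (1/6) - g0 q (1/3)" and ?y = "g0 q (2/3) - g0 q (5/6)"
  have "?x > 0" "?y > 0" using assms by (auto simp: g0_def)
  then have "good_height q (min ?x ?y / 2)"
    by (auto simp: good_height_def min_def field_simps)
  then show ?thesis ..
qed

lemma bump_cases:
  "(a \<le> t \<and> t < a + 1/6 \<and> bump c a t = c) \<or> (a + 1/3 \<le> t \<and> t < a + 1/2 \<and> bump c a t = - c)
    \<or> (\<not> (a \<le> t \<and> t < a + 1/6) \<and> \<not> (a + 1/3 \<le> t \<and> t < a + 1/2) \<and> bump c a t = 0)"
  by (auto simp: bump_def indicator_def)

lemma piece_outside: "t \<notin> {0..1} \<Longrightarrow> piece q c k t = 0"
  using bump_cases[of 0 t c] bump_cases[of "1/2" t c] by (auto simp: piece_def g0_outside)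

lemma bump_abs: "c \<ge> 0 \<Longrightarrow> \<bar>bump c a t\<bar> \<le> c"
  using bump_cases[of a t c] by auto

lemma piece_bounded:
  assumes "q \<ge> 2" "c \<ge> 0"
  shows "\<bar>piece q c k t\<bar> \<le> 1 + 2 * c"
  using assms bump_abs[of c 0 t] bump_abs[of c "1/2" t] g0_nonneg[of q t] g0_le_1[of q t]
  by (auto simp: piece_def)

text \<open>The supports lie in \<open>{0..<1/2}\<close> and \<open>{1/2..<1}\<close>; half-open
  steps keep the point 1/2 from being shared.\<close>

lemma bump_disjoint: "bump c 0 t * bump c (1/2) t = 0"
  using bump_cases[of 0 t c] bump_cases[of "1/2" t c] by auto

lemma sum_pieces: "(\<Sum>k<3. piece q c k t) = g0 q t"
  by (simp add: piece_def eval_nat_numeral)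

text \<open>Only the positive steps lower \<open>g0\<close>, and there \<open>g0\<close> is at least
  its value at 1/6 or 2/3, hence at least \<open>c\<close>.\<close>

lemma piece_0_nonneg:
  assumes q: "q \<ge> 2" and c: "good_height q c"
  shows "0 \<le> piece q c 0 t"
proof (cases "t \<in> {0..1}")
  case True
  have "0 < c" "c \<le> g0 q (1/6)" "c \<le> g0 q (2/3)"
    using c g0_nonneg[of q "1/3"] g0_nonneg[of q "5/6"] by (auto simp: good_height_def)
  moreover have "t < 1/6 \<Longrightarrow> g0 q (1/6) \<le> g0 q t" "t < 2/3 \<Longrightarrow> g0 q (2/3) \<le> g0 q t"
    using True q by (auto intro!: g0_antimono)
  ultimately show ?thesis
    using bump_cases[of 0 t c] bump_cases[of "1/2" t c] g0_nonneg[of q t]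
    by (auto simp: piece_def)
qed (simp add: piece_outside)

text \<open>The exponents count the letters and are uniform in \<open>t\<close>, so integrals of
  products become mixed moments.\<close>

lemma prod_pieces_eq_monomial:
  fixes N :: nat
  shows "\<exists>m n l. \<forall>t. (\<Prod>k<N. piece q c (w k) t)
      = piece q c 0 t ^ m * bump c 0 t ^ n * bump c (1/2) t ^ l"
proof (induction N)
  case 0
  show ?case by (rule exI[of _ 0])+ simp
next
  case (Suc N)
  then obtain m n l where eq: "\<And>t. (\<Prod>k<N. piece q c (w k) t) = piece q c 0 t ^ m * bump c 0 t ^ n * bump c (1/2) t ^ l"
    by blast
  consider "w N = 0" | "w N = 1" | "w N \<noteq> 0" "w N \<noteq> 1" by blast
  then show ?case
  proof cases
    case 1
    show ?thesis by (rule exI[of _ "Suc m"], rule exI[of _ n], rule exI[of _ l]) (simp add: eq 1)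
  next
    case 2
    then have p: "piece q c (w N) t = bump c 0 t" for t by (simp add: piece_def)
    show ?thesis by (rule exI[of _ m], rule exI[of _ "Suc n"], rule exI[of _ l]) (simp add: eq p)
  next
    case 3
    then have p: "piece q c (w N) t = bump c (1/2) t" for t by (simp add: piece_def)
    show ?thesis by (rule exI[of _ m], rule exI[of _ n], rule exI[of _ "Suc l"]) (simp add: eq p)
  qed
qed

text \<open>For even \<open>n\<close> the integrand is nonnegative. For odd \<open>n\<close> the
  larger values of \<open>u\<close> meet the positive step, so the integrand dominates a two-step
  function of mean zero.\<close>

lemma integral_monomial_nonneg:
  assumes q: "q \<ge> 2" and c: "good_height q c" and a: "a = 0 \<or> a = 1/2"
  shows "0 \<le> (\<integral>t. piece q c 0 t ^ m * bump c a t ^ n \<partial>lborel)"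
proof (cases "even n")
  case True
  \<comment> \<open>For \<open>m = n = 0\<close> the integrand is the constant 1 on the line and its
    integral is the default value 0, which is still nonnegative.\<close>
  then show ?thesis
    using piece_0_nonneg[OF q c] by (intro Bochner_Integration.integral_nonneg) (auto simp: zero_le_even_power)
next
  case False
  have cpos: "c > 0" using c by (simp add: good_height_def)
  \<comment> \<open>\<open>K\<close> separates the two steps: \<open>u\<close> is at least
    \<open>K\<close> on the positive and at most \<open>K\<close> on the negative one.\<close>
  define K where "K = g0 q (a + 1/3) + c"
  \<comment> \<open>This is \<open>K ^ m * bump c a t ^ n\<close> for odd \<open>n\<close>; the
    equal step lengths give it integral 0.\<close>
  define f where "f t = c ^ n * K ^ m * (indicator {a..<a+1/6} t - indicator {a+1/3..<a+1/2} t)" for t :: real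
  have "K \<le> g0 q (a + 1/6) - c"
  proof (cases "a = 0")
    case False
    with a have "a + 1/3 = 5/6" "a + 1/6 = 2/3" by simp_all
    then show ?thesis using c unfolding K_def by (simp only: good_height_def)
  qed (use c in \<open>simp add: K_def good_height_def\<close>)
  then have K: "0 \<le> K" "K \<le> g0 q (a + 1/6) - c"
    using g0_nonneg[of q "a + 1/3"] cpos by (auto simp: K_def)
  have le: "f t \<le> piece q c 0 t ^ m * bump c a t ^ n" for t
  proof -
    consider "a \<le> t" "t < a + 1/6" "bump c a t = c" | "a + 1/3 \<le> t" "t < a + 1/2" "bump c a t = - c"
      | "\<not> (a \<le> t \<and> t < a + 1/6)" "\<not> (a + 1/3 \<le> t \<and> t < a + 1/2)" "bump c a t = 0"
      using bump_cases[of a t c] by blast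
    then show ?thesis
    proof cases
      case 1
      then have "piece q c 0 t = g0 q t - c"
        using a bump_cases[of 0 t c] bump_cases[of "1/2" t c] by (auto simp: piece_def)
      moreover have "g0 q (a + 1/6) \<le> g0 q t" using 1 a q by (intro g0_antimono) auto
      ultimately have "K ^ m \<le> piece q c 0 t ^ m" using K by (intro power_mono) auto
      then have "c ^ n * K ^ m \<le> c ^ n * piece q c 0 t ^ m" using cpos by (intro mult_left_mono) auto
      with 1 show ?thesis by (simp add: f_def mult.commute)
    next
      case 2
      then have p: "piece q c 0 t = g0 q t + c"
        using a bump_cases[of 0 t c] bump_cases[of "1/2" t c] by (auto simp: piece_def)
      moreover have "g0 q t \<le> g0 q (a + 1/3)" using 2 a q by (intro g0_antimono) auto
      ultimately have "piece q c 0 t ^ m \<le> K ^ m"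
        using K cpos g0_nonneg[of q t] by (intro power_mono) (auto simp: K_def)
      then have "c ^ n * piece q c 0 t ^ m \<le> c ^ n * K ^ m" using cpos by (intro mult_left_mono) auto
      with 2 False show ?thesis by (simp add: f_def mult.commute power_minus_odd)
    next
      case 3
      with False show ?thesis by (auto simp: f_def odd_pos power_0_left)
    qed
  qed
  have fi: "integrable lborel f" and "integral\<^sup>L lborel f = 0"
    using integral_indicator_Ico[of a "a + 1/6"] integral_indicator_Ico[of "a + 1/3" "a + 1/2"]
    unfolding f_def by auto
  moreover have "integral\<^sup>L lborel f \<le> (\<integral>t. piece q c 0 t ^ m * bump c a t ^ n \<partial>lborel)"
  proof (rule integral_mono[OF fi _ le])
    have "\<bar>piece q c 0 t ^ m * bump c a t ^ n\<bar> \<le> (1 + 2 * c) ^ m * c ^ n" for t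
      unfolding abs_mult power_abs using cpos q
      by (intro mult_mono power_mono piece_bounded bump_abs) auto
    \<comment> \<open>An odd \<open>n\<close> is positive, so the bump factor vanishes off the unit
      interval even when \<open>m = 0\<close>.\<close>
    moreover have "piece q c 0 t ^ m * bump c a t ^ n = 0" if "t \<notin> {0..1}" for t
      using that a False bump_cases[of a t c] by (auto simp: odd_pos power_0_left)
    ultimately show "integrable lborel (\<lambda>t. piece q c 0 t ^ m * bump c a t ^ n)"
      by (intro integrable_unit_interval[where B="(1 + 2 * c) ^ m * c ^ n"]) auto
  qed
  ultimately show ?thesis by simp
qed

text \<open>A monomial containing both bumps vanishes identically, so one-bump moments
  remain.\<close>

lemma integral_prod_pieces_nonneg:
  fixes N :: nat
  assumes q: "q \<ge> 2" and c: "good_height q c"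
  shows "0 \<le> (\<integral>t. (\<Prod>k<N. piece q c (w k) t) \<partial>lborel)"
proof -
  obtain m n l where eq: "\<And>t. (\<Prod>k<N. piece q c (w k) t)
      = piece q c 0 t ^ m * bump c 0 t ^ n * bump c (1/2) t ^ l"
    using prod_pieces_eq_monomial by blast
  consider "l = 0" | "n = 0" | "l > 0" "n > 0" by blast
  then show ?thesis
  proof cases
    case 1
    then show ?thesis using integral_monomial_nonneg[OF q c, of 0 m n] by (simp add: eq)
  next
    case 2
    then show ?thesis using integral_monomial_nonneg[OF q c, of "1/2" m l] by (simp add: eq)
  next
    case 3
    then have "(\<lambda>t. \<Prod>k<N. piece q c (w k) t) = (\<lambda>_. 0)"
      unfolding eq mult.assoc using bump_disjoint[of c] by (auto simp: fun_eq_iff)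
    then show ?thesis by simp
  qed
qed

text \<open>\<open>N > 0\<close> excludes the empty product, which is the constant 1 and not
  integrable on the line.\<close>

lemma integrable_prod_pieces:
  fixes N :: nat
  assumes q: "q \<ge> 2" and c: "c \<ge> 0" and N: "N > 0"
  shows "integrable lborel (\<lambda>t. \<Prod>k<N. piece q c (w k) t)"
proof (rule integrable_unit_interval)
  show "\<bar>\<Prod>k<N. piece q c (w k) t\<bar> \<le> (1 + 2 * c) ^ N" for t
  proof -
    have "(\<Prod>k<N. \<bar>piece q c (w k) t\<bar>) \<le> (\<Prod>k<N. 1 + 2 * c)"
      by (intro prod_mono conjI piece_bounded q c) auto
    then show ?thesis by (simp add: abs_prod)
  qed
  show "(\<Prod>k<N. piece q c (w k) t) = 0" if "t \<notin> {0..1}" for t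
    using N that by (auto simp: piece_outside)
qed measurable

text \<open>Either the bump lies beyond \<open>x\<close>, or both steps lie before \<open>x\<close>
  and cancel. At \<open>x = a\<close> a single point of the bump is met, hence the almost-everywhere
  argument.\<close>

lemma bump_antiderivative_eq_0:
  assumes "x \<le> a \<or> a + 1/2 \<le> x" "0 \<le> a"
  shows "(\<integral>t. indicator {0..x} t * bump c a t \<partial>lborel) = 0"
proof -
  have "AE t in lborel. indicator {0..x} t * bump c a t
      = (if a + 1/2 \<le> x then bump c a t else 0)"
    using AE_lborel_singleton[of a]
    by eventually_elim (use assms bump_cases in \<open>auto simp: bump_def indicator_def\<close>)
  then have "(\<integral>t. indicator {0..x} t * bump c a t \<partial>lborel)
      = (\<integral>t. (if a + 1/2 \<le> x then bump c a t else 0) \<partial>lborel)"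
    by (intro integral_cong_AE) auto
  also have "\<dots> = 0"
  proof (cases "a + 1/2 \<le> x")
    case True
    then show ?thesis
      using integral_indicator_Ico[of a "a + 1/6"] integral_indicator_Ico[of "a + 1/3" "a + 1/2"]
      by (simp add: bump_def)
  qed simp
  finally show ?thesis .
qed

text \<open>Moving a step of length 1/6 to the right by 1/3 lowers its pairing with
  \<open>1 - t\<close> by 1/18, whatever \<open>a\<close> is.\<close>

lemma bump_kernel_integral:
  "(\<integral>t. bump c a t * (1 - t) \<partial>lborel) = c / 18"
proof -
  let ?I = "{a..<a+1/6}" and ?J = "{a+1/3..<a+1/2}"
  have "(\<integral>t. bump c a t * (1 - t) \<partial>lborel)
      = (\<integral>t. c * (indicator ?I t * (1 - t) - indicator ?J t * (1 - t)) \<partial>lborel)"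
    by (simp only: bump_def left_diff_distrib mult.assoc)
  also have "\<dots> = c * ((\<integral>t. indicator ?I t * (1 - t) \<partial>lborel) - (\<integral>t. indicator ?J t * (1 - t) \<partial>lborel))"
    by (subst integral_mult_right_zero, subst Bochner_Integration.integral_diff)
       (auto intro!: integral_linear_Ico)
  also have "\<dots> = c / 18"
    by (subst (1 2) integral_linear_Ico) (auto simp: power2_eq_square field_simps)
  finally show ?thesis .
qed

subsection \<open>Fooling functions\<close>

text \<open>Young's inequality, as the tangent-line bound for the \<open>q\<close>-th power at
  \<open>y\<close>: Bernoulli's inequality for \<open>x / y\<close>, scaled by
  \<open>y ^ q\<close>.\<close>

lemma young_power:
  fixes x y :: real
  assumes q: "q \<ge> 2" and xy: "0 \<le> x" "0 \<le> y"
  shows "real q * (x * y ^ (q - 1)) \<le> x ^ q + (real q - 1) * y ^ q"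
proof (cases "y = 0")
  case True
  with q xy show ?thesis by (simp add: power_0_left)
next
  case False
  with xy have y: "y > 0" by simp
  have "1 + real q * (x / y - 1) \<le> (1 + (x / y - 1)) ^ q"
    using xy by (intro Bernoulli_inequality) simp
  then have "y ^ q * (1 + real q * (x / y - 1)) \<le> y ^ q * (x / y) ^ q"
    using y by (intro mult_left_mono) auto
  also have "\<dots> = x ^ q" using y by (simp add: power_divide)
  finally have "y ^ q * (1 + real q * (x / y - 1)) \<le> x ^ q" .
  moreover have "y ^ q = y * y ^ (q - 1)" using q by (simp flip: power_Suc)
  then have "y ^ q * (1 + real q * (x / y - 1)) = real q * (x * y ^ (q - 1)) - (real q - 1) * y ^ q"
    using y by (simp add: field_simps)
  ultimately show ?thesis by simp
qed

lemma sum_UNION_le: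
  fixes f :: "'b \<Rightarrow> real"
  assumes "finite I" and "\<And>i. i \<in> I \<Longrightarrow> finite (B i)" and f: "\<And>x. 0 \<le> f x"
  shows "sum f (\<Union>i\<in>I. B i) \<le> (\<Sum>i\<in>I. sum f (B i))"
  using assms(1,2)
proof (induction I rule: finite_induct)
  case (insert i I)
  have "sum f (B i \<union> (\<Union>i\<in>I. B i)) \<le> sum f (B i) + sum f (\<Union>i\<in>I. B i)"
    using insert.hyps insert.prems by (subst sum_Un) (auto intro!: sum_nonneg f)
  with insert show ?case by force
qed simp

section \<open>Constants and weights for a fixed admissible height\<close>

locale fooling =
  fixes q :: nat and c :: real
  assumes q: "q \<ge> 2" and even_q: "even q" and c: "good_height q c"
begin

text \<open>By \<open>g0_mult_kernel\<close> this is also the \<open>q\<close>-th power of the norm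
  of \<open>g0\<close>.\<close>

definition A :: real where "A = (\<integral>t. g0 q t * (1 - t) \<partial>lborel)"

definition weight :: "nat \<Rightarrow> real" where "weight k = (\<integral>t. piece q c k t * (1 - t) \<partial>lborel)"

definition words :: "nat \<Rightarrow> (nat \<Rightarrow> nat) set" where "words d = PiE {..<d} (\<lambda>_. {..<3})"

definition tensor :: "nat \<Rightarrow> (nat \<Rightarrow> nat) \<Rightarrow> (nat \<Rightarrow> real) \<Rightarrow> real" where
  "tensor d w t = (\<Prod>j<d. piece q c (w j) (t j))"

lemma c_pos: "c > 0" using c by (simp add: good_height_def)

lemma finite_words: "finite (words d)"
  unfolding words_def by (intro finite_PiE) auto

lemma integrable_piece_times:
  assumes [measurable]: "h \<in> borel_measurable borel" and h: "\<And>t. t \<in> {0..1} \<Longrightarrow> \<bar>h t\<bar> \<le> 1"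
  shows "integrable lborel (\<lambda>t. piece q c k t * h t)"
proof (rule integrable_unit_interval)
  show "\<bar>piece q c k t * h t\<bar> \<le> (1 + 2 * c) * 1" if "t \<in> {0..1}" for t
    unfolding abs_mult using h[OF that] q c_pos
    by (intro mult_mono piece_bounded) auto
qed (simp_all add: piece_outside)

lemma integrable_piece: "integrable lborel (piece q c k)"
  using integrable_piece_times[of "\<lambda>_. 1" k] by simp

lemma integrable_indicator_piece: "integrable lborel (\<lambda>t. indicator {0..x} t * piece q c k t)"
  using integrable_mult_indicator[OF _ integrable_piece, of "{0..x}" k] by simp

lemma integrable_piece_kernel: "integrable lborel (\<lambda>t. piece q c k t * (1 - t))"
  by (rule integrable_piece_times) auto

lemma g0_mult_kernel: "g0 q t * (1 - t) = g0 q t ^ q"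
proof -
  have "g0 q t ^ q = g0 q t * g0 q t ^ (q - 1)" using q by (simp flip: power_Suc)
  then show ?thesis using q by (simp add: g0_power) (simp add: g0_def indicator_def)
qed

lemma integrable_g0_power: "integrable lborel (\<lambda>t. g0 q t ^ q)"
proof (rule integrable_unit_interval)
  show "\<bar>g0 q t ^ q\<bar> \<le> 1" for t
    using q g0_nonneg[of q t] g0_le_1[of q t] by (simp add: power_le_one)
qed (use q in \<open>auto simp: g0_outside\<close>)

lemma integral_g0_power: "(\<integral>t. g0 q t ^ q \<partial>lborel) = A"
  by (simp add: A_def g0_mult_kernel)

lemma weight_bump: "weight 1 = c / 18" "weight 2 = c / 18"
  by (simp_all add: weight_def piece_def bump_kernel_integral)

lemma weight_nonneg: "0 \<le> weight k"
proof -
  have "0 \<le> weight 0"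
    unfolding weight_def
  proof (intro Bochner_Integration.integral_nonneg)
    show "0 \<le> piece q c 0 t * (1 - t)" for t
      using piece_0_nonneg[OF q c, of t] piece_outside[of t q c 0]
      by (cases "t \<in> {0..1}") auto
  qed
  \<comment> \<open>\<open>piece\<close> treats every index other than 0 and 1 as \<open>w\<close>,
    so index 2 covers the rest.\<close>
  moreover have "weight k = weight 2" if "k \<noteq> 0" "k \<noteq> 1"
    using that by (simp add: weight_def piece_def)
  ultimately show ?thesis
    using weight_bump c_pos by (metis divide_nonneg_pos less_imp_le zero_less_numeral)
qed

lemma sum_weight: "(\<Sum>k<3. weight k) = A"
proof -
  have "(\<Sum>k<3. weight k) = (\<integral>t. (\<Sum>k<3. piece q c k t * (1 - t)) \<partial>lborel)"
    unfolding weight_def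
    by (rule Bochner_Integration.integral_sum[symmetric]) (rule integrable_piece_kernel)
  also have "\<dots> = A"
    by (simp only: A_def sum_pieces flip: sum_distrib_right)
  finally show ?thesis .
qed

text \<open>The two bumps alone contribute \<open>c / 18\<close> each; this keeps
  \<open>\<theta>\<close> positive.\<close>

lemma A_ge: "c / 9 \<le> A"
  using sum_weight weight_nonneg[of 0] weight_bump by (simp add: eval_nat_numeral)

lemma A_pos: "A > 0"
  using A_ge c_pos by simp

section \<open>Tensor products indexed by words, and their norms\<close>

lemma tensor_measurable [measurable]: "tensor d w \<in> borel_measurable (cube_meas d)"
  unfolding tensor_def by (intro borel_measurable_prod) measurable

lemma sum_tensor_words: "(\<Sum>w\<in>words d. tensor d w t) = (\<Prod>j<d. g0 q (t j))"
proof -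
  have "(\<Prod>j<d. \<Sum>k<3. piece q c k (t j)) = (\<Sum>w\<in>words d. tensor d w t)"
    unfolding words_def tensor_def by (rule prod_sum_PiE) auto
  then show ?thesis by (simp only: sum_pieces)
qed

lemma sum_weight_words: "(\<Sum>w\<in>words d. \<Prod>j<d. weight (w j)) = A ^ d"
proof -
  have "(\<Prod>j<d. \<Sum>k<3. weight k) = (\<Sum>w\<in>words d. \<Prod>j<d. weight (w j))"
    unfolding words_def by (rule prod_sum_PiE) auto
  then show ?thesis by (simp only: sum_weight) simp
qed

text \<open>Expand over \<open>q\<close>-tuples of words and swap the products: grouped by
  coordinate, each term integrates to a product of univariate mixed moments.\<close>

lemma power_sum_tensor:
  assumes "finite S"
  shows "(\<Sum>w\<in>S. tensor d w t) ^ q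
    = (\<Sum>\<sigma>\<in>PiE {..<q} (\<lambda>_. S). \<Prod>j<d. \<Prod>k<q. piece q c (\<sigma> k j) (t j))"
proof -
  have "(\<Sum>w\<in>S. tensor d w t) ^ q = (\<Prod>k<q. \<Sum>w\<in>S. tensor d w t)" by simp
  also have "\<dots> = (\<Sum>\<sigma>\<in>PiE {..<q} (\<lambda>_. S). \<Prod>k<q. tensor d (\<sigma> k) t)"
    using assms by (intro prod_sum_PiE) auto
  also have "\<dots> = (\<Sum>\<sigma>\<in>PiE {..<q} (\<lambda>_. S). \<Prod>j<d. \<Prod>k<q. piece q c (\<sigma> k j) (t j))"
    unfolding tensor_def by (subst prod.swap) simp
  finally show ?thesis .
qed

lemma integral_power_sum_tensor:
  assumes S: "finite S"
  shows "integrable (cube_meas d) (\<lambda>t. (\<Sum>w\<in>S. tensor d w t) ^ q)"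
    and "(\<integral>t. (\<Sum>w\<in>S. tensor d w t) ^ q \<partial>cube_meas d)
      = (\<Sum>\<sigma>\<in>PiE {..<q} (\<lambda>_. S). \<Prod>j<d. \<integral>t. (\<Prod>k<q. piece q c (\<sigma> k j) t) \<partial>lborel)"
proof -
  have int: "integrable lborel (\<lambda>t. \<Prod>k<q. piece q c (\<sigma> k j) t)" for \<sigma> :: "nat \<Rightarrow> nat \<Rightarrow> nat" and j
    using q c_pos by (intro integrable_prod_pieces) auto
  have int_d: "integrable (cube_meas d) (\<lambda>t. \<Prod>j<d. \<Prod>k<q. piece q c (\<sigma> k j) (t j))"
    and val: "(\<integral>t. (\<Prod>j<d. \<Prod>k<q. piece q c (\<sigma> k j) (t j)) \<partial>cube_meas d)
      = (\<Prod>j<d. \<integral>t. (\<Prod>k<q. piece q c (\<sigma> k j) t) \<partial>lborel)" for \<sigma> :: "nat \<Rightarrow> nat \<Rightarrow> nat"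
    by (intro integrable_cube_prod int, intro integral_cube_prod int)
  show "integrable (cube_meas d) (\<lambda>t. (\<Sum>w\<in>S. tensor d w t) ^ q)"
    unfolding power_sum_tensor[OF S] by (intro Bochner_Integration.integrable_sum int_d)
  show "(\<integral>t. (\<Sum>w\<in>S. tensor d w t) ^ q \<partial>cube_meas d)
      = (\<Sum>\<sigma>\<in>PiE {..<q} (\<lambda>_. S). \<Prod>j<d. \<integral>t. (\<Prod>k<q. piece q c (\<sigma> k j) t) \<partial>lborel)"
    unfolding power_sum_tensor[OF S] val[symmetric]
    by (intro Bochner_Integration.integral_sum int_d)
qed

lemma integral_prod_g0_power:
  "integrable (cube_meas d) (\<lambda>t. (\<Prod>j<d. g0 q (t j)) ^ q)"
  "(\<integral>t. (\<Prod>j<d. g0 q (t j)) ^ q \<partial>cube_meas d) = A ^ d"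
  using integrable_cube_prod[of d "\<lambda>_ t. g0 q t ^ q"] integral_cube_prod[of d "\<lambda>_ t. g0 q t ^ q"]
  by (simp_all add: prod_power_distrib integrable_g0_power integral_g0_power)

text \<open>All mixed moments of the pieces are nonnegative, so deleting words can only shrink the norm.\<close>
lemma integral_power_sub_tensor_le:
  assumes "S \<subseteq> words d"
  shows "(\<integral>t. (\<Sum>w\<in>S. tensor d w t) ^ q \<partial>cube_meas d) \<le> A ^ d"
proof -
  have S: "finite S" using assms finite_words finite_subset by blast
  have "(\<integral>t. (\<Sum>w\<in>S. tensor d w t) ^ q \<partial>cube_meas d)
      \<le> (\<integral>t. (\<Sum>w\<in>words d. tensor d w t) ^ q \<partial>cube_meas d)"
    unfolding integral_power_sum_tensor(2)[OF S] integral_power_sum_tensor(2)[OF finite_words]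
    using assms
    by (intro sum_mono2 prod_nonneg ballI integral_prod_pieces_nonneg q c finite_PiE PiE_mono)
       (auto simp: finite_words)
  then show ?thesis by (simp add: sum_tensor_words integral_prod_g0_power)
qed

text \<open>The norm of the tensor power of \<open>g0\<close>; dividing by it normalises the fooling
  functions.\<close>

definition norm_h :: "nat \<Rightarrow> real" where "norm_h d = root q (A ^ d)"

lemma norm_h_pos: "norm_h d > 0"
  unfolding norm_h_def using q A_pos by simp

lemma norm_h_power: "norm_h d ^ q = A ^ d"
  unfolding norm_h_def using q A_pos by simp

text \<open>Hoelder's inequality, obtained by integrating a pointwise Young inequality.\<close>

lemma I_int_le:
  assumes "f \<in> F_ball (real q) d"
  shows "\<bar>I_int d f\<bar> \<le> A ^ d / norm_h d"
proof -
  let ?M = "cube_meas d" and ?L = "norm_h d"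
  let ?H = "\<lambda>t. \<Prod>j<d. g0 q (t j)"
  from assms obtain g where g [measurable]: "g \<in> borel_measurable ?M"
    and le1: "(\<integral>\<^sup>+ t \<in> unit_cube d. ennreal (\<bar>g t\<bar> powr real q) \<partial>?M) \<le> 1"
    and f: "\<And>x. x \<in> unit_cube d \<Longrightarrow> f x = (LINT t : anchored_box d x | ?M. g t)"
    unfolding F_ball_def by blast
  have q1: "real q \<ge> 1" using q by simp
  note gi = F_ball_integrable[OF q1 g le1]
  have pw: "\<bar>x\<bar> powr real q = \<bar>x\<bar> ^ q" for x :: real
    using q by (simp add: powr_realpow')
  \<comment> \<open>Young's bound for \<open>?L * \<bar>g t\<bar>\<close> and \<open>?H t\<close>,
    divided by \<open>q * ?L\<close>. Since \<open>?L ^ q = A ^ d\<close>, the two terms integrate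
    to at most 1 and \<open>q - 1\<close> multiples of \<open>A ^ d\<close>.\<close>
  let ?b = "\<lambda>t. (A ^ d * (indicator (unit_cube d) t * \<bar>g t\<bar> ^ q) + (real q - 1) * ?H t ^ q) / (real q * ?L)"
  have bound_int: "integrable ?M ?b"
    using gi(1) integral_prod_g0_power(1)[of d] by (auto simp: set_integrable_def pw)
  have le: "\<bar>indicator (unit_cube d) t *\<^sub>R (g t * (\<Prod>j<d. 1 - t j))\<bar> \<le> ?b t" for t
  proof (cases "t \<in> unit_cube d")
    case True
    then have "1 - t j = g0 q (t j) ^ (q - 1)" if "j < d" for j
      using that unfolding g0_power[OF q] by (simp add: unit_cube_def PiE_iff)
    then have "(\<Prod>j<d. 1 - t j) = ?H t ^ (q - 1)"
      unfolding prod_power_distrib by (intro prod.cong) auto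
    moreover have H: "0 \<le> ?H t" by (intro prod_nonneg) (simp add: g0_nonneg)
    ultimately have eq: "\<bar>indicator (unit_cube d) t *\<^sub>R (g t * (\<Prod>j<d. 1 - t j))\<bar> = \<bar>g t\<bar> * ?H t ^ (q - 1)"
      using True by (simp add: abs_mult)
    have "real q * (?L * \<bar>g t\<bar> * ?H t ^ (q - 1)) \<le> (?L * \<bar>g t\<bar>) ^ q + (real q - 1) * ?H t ^ q"
      using young_power[OF q _ H, of "?L * \<bar>g t\<bar>"] norm_h_pos[of d] by simp
    then show ?thesis
      unfolding eq using True q norm_h_pos[of d]
      by (simp add: power_mult_distrib norm_h_power le_divide_eq mult_ac)
  next
    case False
    have "0 \<le> ?H t" by (intro prod_nonneg) (simp add: g0_nonneg)
    with False show ?thesis using q norm_h_pos[of d] by simp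
  qed
  have int: "integrable ?M (\<lambda>t. indicator (unit_cube d) t *\<^sub>R (g t * (\<Prod>j<d. 1 - t j)))"
  proof (rule Bochner_Integration.integrable_bound[OF bound_int])
    show "AE t in ?M. norm (indicator (unit_cube d) t *\<^sub>R (g t * (\<Prod>j<d. 1 - t j))) \<le> norm (?b t)"
      unfolding real_norm_def by (intro AE_I2 order_trans[OF le abs_ge_self])
  qed measurable
  have "\<bar>I_int d f\<bar> = \<bar>\<integral>t. indicator (unit_cube d) t *\<^sub>R (g t * (\<Prod>j<d. 1 - t j)) \<partial>?M\<bar>"
    using I_int_eq_kernel_integral[OF g gi(2) f] by (simp add: set_lebesgue_integral_def)
  also have "\<dots> \<le> (\<integral>t. ?b t \<partial>?M)"
    by (rule order_trans[OF integral_abs_bound integral_mono[OF _ bound_int le]])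
       (rule integrable_abs[OF int])
  also have "\<dots> = (A ^ d * (LINT t : unit_cube d | ?M. \<bar>g t\<bar> powr real q) + (real q - 1) * A ^ d)
      / (real q * ?L)"
    using gi(1) integral_prod_g0_power[of d]
    by (simp add: set_integrable_def set_lebesgue_integral_def pw)
  also have "\<dots> \<le> (A ^ d * 1 + (real q - 1) * A ^ d) / (real q * ?L)"
    using gi(3) A_pos norm_h_pos[of d] by (intro divide_right_mono add_right_mono mult_left_mono) auto
  also have "\<dots> = A ^ d / ?L"
    using q norm_h_pos[of d] by (simp add: field_simps)
  finally show ?thesis .
qed

text \<open>The share of \<open>A\<close> left after removing one bump, as
  \<open>\<theta> * A = A - c / 18\<close>.\<close>

definition \<theta> :: real where "\<theta> = 1 - c / (18 * A)"

lemma \<theta>_bounds: "0 < \<theta>" "\<theta> < 1"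
  using A_ge A_pos c_pos by (auto simp: \<theta>_def field_simps)

definition antideriv :: "nat \<Rightarrow> real \<Rightarrow> real" where
  "antideriv k x = (\<integral>t. indicator {0..x} t * piece q c k t \<partial>lborel)"

text \<open>Up to 1/2 the second bump has not begun; beyond 1/2 the first has already
  cancelled.\<close>

lemma antideriv_bump_eq_0: "antideriv 1 x = 0 \<or> antideriv 2 x = 0"
proof (cases "x \<le> 1/2")
  case True
  then show ?thesis
    using bump_antiderivative_eq_0[of x "1/2" c] by (simp add: antideriv_def piece_def)
next
  case False
  then show ?thesis
    using bump_antiderivative_eq_0[of x 0 c] by (simp add: antideriv_def piece_def)
qed

text \<open>At a fixed node every coordinate annihilates one of the two bumps, so the surviving words
  carry an exponentially small share of the total weight.\<close>
lemma sum_weight_surviving: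
  "(\<Sum>w | w \<in> words d \<and> (\<Prod>j<d. antideriv (w j) (x j)) \<noteq> 0. \<Prod>j<d. weight (w j)) \<le> (\<theta> * A) ^ d"
proof -
  let ?K = "\<lambda>j. {k. k < 3 \<and> antideriv k (x j) \<noteq> 0}"
  have one: "(\<Sum>k\<in>?K j. weight k) \<le> \<theta> * A" for j
  proof -
    obtain k where k: "k = 1 \<or> k = 2" "antideriv k (x j) = 0"
      using antideriv_bump_eq_0[of "x j"] by blast
    have "(\<Sum>k\<in>?K j. weight k) \<le> (\<Sum>k\<in>{..<3} - {k}. weight k)"
      using k by (intro sum_mono2) (auto simp: weight_nonneg)
    also have "\<dots> = A - weight k"
      using k sum_diff1[of "{..<3::nat}" weight k] sum_weight by auto
    also have "\<dots> = \<theta> * A"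
      using k(1) weight_bump A_pos by (auto simp: \<theta>_def field_simps)
    finally show ?thesis .
  qed
  have "(\<Sum>w | w \<in> words d \<and> (\<Prod>j<d. antideriv (w j) (x j)) \<noteq> 0. \<Prod>j<d. weight (w j))
      \<le> (\<Sum>w\<in>PiE {..<d} ?K. \<Prod>j<d. weight (w j))"
    by (intro sum_mono2 prod_nonneg ballI weight_nonneg finite_PiE)
       (auto simp: words_def PiE_iff extensional_def)
  also have "\<dots> = (\<Prod>j<d. \<Sum>k\<in>?K j. weight k)"
    by (rule prod_sum_PiE[symmetric]) auto
  also have "\<dots> \<le> (\<Prod>j<d. \<theta> * A)"
    by (intro prod_mono conjI one sum_nonneg weight_nonneg)
  finally show ?thesis by simp
qed

lemma fooling_function:
  assumes xs: "set xs \<subseteq> half_open_cube d"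
  obtains f where "f \<in> F_ball (real q) d" "\<And>x. x \<in> set xs \<Longrightarrow> f x = 0"
    "I_int d f \<ge> (1 - real (length xs) * \<theta> ^ d) * (A ^ d / norm_h d)"
proof -
  let ?M = "cube_meas d" and ?L = "norm_h d"
  \<comment> \<open>Every retained word vanishes at every node by itself, so no cancellation between
    words is involved.\<close>
  define S where "S = {w \<in> words d. \<forall>x\<in>set xs. (\<Prod>j<d. antideriv (w j) (x j)) = 0}"
  define g where "g t = (\<Sum>w\<in>S. tensor d w t) / ?L" for t
  define f where "f x = (LINT t : anchored_box d x | ?M. g t)" for x
  have S: "S \<subseteq> words d" "finite S"
    using finite_words finite_subset by (auto simp: S_def)
  have g_meas [measurable]: "g \<in> borel_measurable ?M"
    unfolding g_def by measurable
  have tensor_int: "integrable ?M (tensor d w)" for w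
    unfolding tensor_def by (intro integrable_cube_prod integrable_piece)
  have "integrable ?M g"
    unfolding g_def using tensor_int by auto
  then have gi: "set_integrable ?M (unit_cube d) g"
    unfolding set_integrable_def by (intro integrable_mult_indicator) auto
  \<comment> \<open>Evenness of \<open>q\<close> enters here: \<open>g\<close> may change sign, yet
    its \<open>q\<close>-th absolute power is a polynomial in the pieces.\<close>
  have gq: "\<bar>g t\<bar> powr real q = (\<Sum>w\<in>S. tensor d w t) ^ q / A ^ d" for t
  proof -
    have "\<bar>g t\<bar> powr real q = g t ^ q"
      using q even_q by (simp add: powr_realpow' power_even_abs)
    then show ?thesis by (simp add: g_def power_divide norm_h_power)
  qed
  have gq_int: "integrable ?M (\<lambda>t. \<bar>g t\<bar> powr real q)"
    unfolding gq using integral_power_sum_tensor(1)[OF S(2)] by auto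
  have "(\<integral>\<^sup>+ t \<in> unit_cube d. ennreal (\<bar>g t\<bar> powr real q) \<partial>?M)
      \<le> (\<integral>\<^sup>+ t. ennreal (\<bar>g t\<bar> powr real q) \<partial>?M)"
    by (intro nn_integral_mono) (auto simp: indicator_def)
  also have "\<dots> = ennreal (\<integral>t. \<bar>g t\<bar> powr real q \<partial>?M)"
    by (rule nn_integral_eq_integral[OF gq_int]) auto
  also have "\<dots> \<le> 1"
    unfolding gq using integral_power_sub_tensor_le[OF S(1)] A_pos
    by (simp add: ennreal_le_1)
  finally have le1: "(\<integral>\<^sup>+ t \<in> unit_cube d. ennreal (\<bar>g t\<bar> powr real q) \<partial>?M) \<le> 1" .
  have ball: "f \<in> F_ball (real q) d"
    unfolding F_ball_def using le1 f_def g_meas by blast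
  have node: "f x = 0" if x: "x \<in> set xs" for x
  proof -
    have "f x = (\<integral>t. (\<Sum>w\<in>S. \<Prod>j<d. indicator {0..x j} (t j) * piece q c (w j) (t j)) / ?L \<partial>?M)"
      unfolding f_def set_lebesgue_integral_def
      by (rule Bochner_Integration.integral_cong)
         (simp_all add: anchored_box_def indicator_PiE_prod g_def tensor_def sum_distrib_left prod.distrib)
    also have "\<dots> = (\<Sum>w\<in>S. \<integral>t. (\<Prod>j<d. indicator {0..x j} (t j) * piece q c (w j) (t j)) \<partial>?M) / ?L"
      unfolding integral_divide_zero
      by (intro arg_cong2[where f = "(/)"] refl Bochner_Integration.integral_sum
          integrable_cube_prod integrable_indicator_piece)
    also have "\<dots> = (\<Sum>w\<in>S. \<Prod>j<d. antideriv (w j) (x j)) / ?L"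
      unfolding antideriv_def
      by (intro arg_cong2[where f = "(/)"] refl sum.cong integral_cube_prod integrable_indicator_piece)
    also have "\<dots> = 0 / ?L"
      using x by (intro arg_cong2[where f = "(/)"] refl sum.neutral) (simp only: S_def mem_Collect_eq, blast)
    also have "\<dots> = 0" by simp
    finally show ?thesis .
  qed
  have "I_int d f = (LINT t : unit_cube d | ?M. g t * (\<Prod>j<d. 1 - t j))"
    by (rule I_int_eq_kernel_integral[OF g_meas gi]) (simp add: f_def)
  also have "\<dots> = (\<integral>t. (\<Sum>w\<in>S. \<Prod>j<d. piece q c (w j) (t j) * (1 - t j)) / ?L \<partial>?M)"
    unfolding set_lebesgue_integral_def
  proof (rule Bochner_Integration.integral_cong)
    fix t assume t: "t \<in> space ?M"
    have "indicator (unit_cube d) t * tensor d w t = tensor d w t" for w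
      unfolding tensor_def unit_cube_def indicator_PiE_prod[OF t] prod.distrib[symmetric]
      using piece_outside by (intro prod.cong) (force simp: indicator_def)+
    then have "indicator (unit_cube d) t * g t = g t"
      unfolding g_def times_divide_eq_right sum_distrib_left by (simp only:)
    then have "indicator (unit_cube d) t *\<^sub>R (g t * (\<Prod>j<d. 1 - t j)) = g t * (\<Prod>j<d. 1 - t j)"
      by (simp only: real_scaleR_def mult.assoc[symmetric])
    then show "indicator (unit_cube d) t *\<^sub>R (g t * (\<Prod>j<d. 1 - t j))
        = (\<Sum>w\<in>S. \<Prod>j<d. piece q c (w j) (t j) * (1 - t j)) / ?L"
      by (simp add: g_def tensor_def prod.distrib sum_distrib_right)
  qed simp
  also have "\<dots> = (\<Sum>w\<in>S. \<Prod>j<d. weight (w j)) / ?L"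
  proof -
    have "(\<integral>t. (\<Sum>w\<in>S. \<Prod>j<d. piece q c (w j) (t j) * (1 - t j)) \<partial>?M)
        = (\<Sum>w\<in>S. \<integral>t. (\<Prod>j<d. piece q c (w j) (t j) * (1 - t j)) \<partial>?M)"
      by (intro Bochner_Integration.integral_sum integrable_cube_prod integrable_piece_kernel)
    also have "\<dots> = (\<Sum>w\<in>S. \<Prod>j<d. weight (w j))"
      unfolding weight_def by (intro sum.cong refl integral_cube_prod integrable_piece_kernel)
    finally show ?thesis by (simp only: integral_divide_zero)
  qed
  finally have I_eq: "I_int d f = (\<Sum>w\<in>S. \<Prod>j<d. weight (w j)) / ?L" .
  \<comment> \<open>Union bound: a deleted word has a nonzero antiderivative at some node.\<close>
  have "(\<Sum>w\<in>words d - S. \<Prod>j<d. weight (w j))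
      \<le> (\<Sum>w\<in>(\<Union>x\<in>set xs. {w. w \<in> words d \<and> (\<Prod>j<d. antideriv (w j) (x j)) \<noteq> 0}). \<Prod>j<d. weight (w j))"
    by (intro sum_mono2 prod_nonneg ballI weight_nonneg finite_UN_I)
       (auto simp: S_def intro: finite_subset[OF _ finite_words])
  also have "\<dots> \<le> (\<Sum>x\<in>set xs. \<Sum>w | w \<in> words d \<and> (\<Prod>j<d. antideriv (w j) (x j)) \<noteq> 0. \<Prod>j<d. weight (w j))"
    by (intro sum_UNION_le prod_nonneg weight_nonneg) (simp_all add: finite_words)
  also have "\<dots> \<le> (\<Sum>x\<in>set xs. (\<theta> * A) ^ d)"
    by (intro sum_mono sum_weight_surviving)
  \<comment> \<open>Nodes may repeat, so \<open>set xs\<close> can have fewer elements than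
    \<open>length xs\<close>.\<close>
  also have "\<dots> \<le> real (length xs) * (\<theta> * A) ^ d"
    using \<theta>_bounds A_pos by (simp add: mult_right_mono card_length)
  finally have "A ^ d - real (length xs) * (\<theta> * A) ^ d \<le> (\<Sum>w\<in>S. \<Prod>j<d. weight (w j))"
    using sum.subset_diff[OF S(1) finite_words, of "\<lambda>w. \<Prod>j<d. weight (w j)"] sum_weight_words[of d]
    by simp
  then have "(1 - real (length xs) * \<theta> ^ d) * A ^ d / ?L \<le> I_int d f"
    unfolding I_eq using norm_h_pos[of d]
    by (intro divide_right_mono) (simp_all add: power_mult_distrib algebra_simps)
  then show thesis using that[OF ball node] by simp
qed

section \<open>Initial error, minimal error and information complexity\<close>

lemma init_error_eq: "init_error (real q) d = ereal (A ^ d / norm_h d)"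
proof (rule antisym)
  show "init_error (real q) d \<le> ereal (A ^ d / norm_h d)"
    unfolding init_error_def by (intro SUP_least) (simp add: I_int_le)
  \<comment> \<open>Without nodes no word is deleted, and the normalised extremal attains the upper
    bound.\<close>
  obtain f where "f \<in> F_ball (real q) d" "I_int d f \<ge> A ^ d / norm_h d"
    using fooling_function[of "[]" d] by auto
  then show "ereal (A ^ d / norm_h d) \<le> init_error (real q) d"
    unfolding init_error_def by (intro SUP_upper2[of f]) auto
qed

text \<open>On a fooling function all data are zero, so the algorithm returns 0 and errs by the
  whole integral.\<close>

lemma min_error_ge:
  "ereal ((1 - real N * \<theta> ^ d) * (A ^ d / norm_h d)) \<le> min_error (real q) N d"
  unfolding min_error_def
proof (rule INF_greatest, clarify)
  fix xs :: "(nat \<Rightarrow> real) list" and \<phi> :: "real list \<Rightarrow> real"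
  assume xs: "set xs \<subseteq> half_open_cube d" and \<phi>: "\<phi> (replicate (length xs) 0) = 0" and "N = length xs"
  obtain f where f: "f \<in> F_ball (real q) d" "\<And>x. x \<in> set xs \<Longrightarrow> f x = 0"
    "I_int d f \<ge> (1 - real (length xs) * \<theta> ^ d) * (A ^ d / norm_h d)"
    using fooling_function[OF xs] by blast
  have "map f xs = replicate (length xs) 0"
    using f(2) by (simp add: map_replicate_const[symmetric] cong: map_cong)
  with \<phi> f show "ereal ((1 - real (length xs) * \<theta> ^ d) * (A ^ d / norm_h d)) \<le> wc_error (real q) d xs \<phi>"
    unfolding wc_error_def by (intro SUP_upper2[of f]) auto
qed

lemma N_int_ge:
  assumes \<epsilon>: "0 < \<epsilon>"
  shows "real (N_int (real q) \<epsilon> d) \<ge> (1 - \<epsilon>) * (1 / \<theta>) ^ d"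
proof -
  let ?E = "A ^ d / norm_h d" and ?N = "N_int (real q) \<epsilon> d"
  have E: "?E > 0" using A_pos norm_h_pos by simp
  have "\<exists>N. min_error (real q) N d \<le> ereal (\<epsilon> * ?E)"
    by (rule min_error_arbitrarily_small[OF _ mult_pos_pos[OF \<epsilon> E]]) (use q in simp)
  then have "min_error (real q) ?N d \<le> ereal (\<epsilon> * ?E)"
    unfolding N_int_def init_error_eq times_ereal.simps by (rule LeastI_ex)
  then have "ereal ((1 - real ?N * \<theta> ^ d) * ?E) \<le> ereal (\<epsilon> * ?E)"
    by (rule order_trans[OF min_error_ge])
  then have "(1 - real ?N * \<theta> ^ d) * ?E \<le> \<epsilon> * ?E"
    by (simp only: ereal_less_eq)
  then have "1 - real ?N * \<theta> ^ d \<le> \<epsilon>"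
    using E mult_le_cancel_right_pos by blast
  then show ?thesis
    using \<theta>_bounds by (simp add: field_simps)
qed

end

theorem theorem2:
  fixes q :: nat
  assumes "q > 0" and "even q"
  shows "\<exists>C::real. C > 1 \<and> (\<forall>\<epsilon>::real. 0 < \<epsilon> \<and> \<epsilon> < 1 \<longrightarrow>
           (\<exists>r :: nat \<Rightarrow> real. r \<longlonglongrightarrow> 0 \<and>
              (\<forall>d \<ge> 1. real (N_int (real q) \<epsilon> d) \<ge> C ^ d * (1 + r d))))"
proof -
  have q: "q \<ge> 2" using assms by (auto elim!: evenE)
  then obtain c where c: "good_height q c" using good_height_exists by blast
  interpret fooling q c using q assms(2) c by unfold_locales
  \<comment> \<open>The bound has the form \<open>(1 - \<epsilon>) * (1 / \<theta>) ^ d\<close>; the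
    square root gives up half the exponent to absorb \<open>1 - \<epsilon>\<close> with
    \<open>C\<close> independent of \<open>\<epsilon>\<close>.\<close>
  define C where "C = sqrt (1 / \<theta>)"
  have C: "C > 1" "C * C = 1 / \<theta>"
    using \<theta>_bounds by (auto simp: C_def)
  have "\<exists>r :: nat \<Rightarrow> real. r \<longlonglongrightarrow> 0 \<and> (\<forall>d \<ge> 1. real (N_int (real q) \<epsilon> d) \<ge> C ^ d * (1 + r d))"
    if \<epsilon>: "0 < \<epsilon>" "\<epsilon> < 1" for \<epsilon>
  proof (intro exI conjI allI impI)
    \<comment> \<open>As \<open>C\<^sup>2 = 1 / \<theta>\<close>, the bound \<open>C ^ d\<close> follows once \<open>(1 - \<epsilon>) * C ^ d \<ge> 1\<close>.\<close>
    define r :: "nat \<Rightarrow> real" where "r d = (if 1 \<le> (1 - \<epsilon>) * C ^ d then 0 else -1)" for d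
    obtain n where n: "1 / (1 - \<epsilon>) < C ^ n"
      using real_arch_pow[OF C(1)] by blast
    have "r d = 0" if "d \<ge> n" for d
    proof -
      have "C ^ n \<le> C ^ d" using C(1) that by (intro power_increasing) auto
      with n have "1 / (1 - \<epsilon>) \<le> C ^ d" by simp
      with \<epsilon> show ?thesis by (simp add: r_def divide_le_eq mult.commute)
    qed
    then show "r \<longlonglongrightarrow> 0"
      by (intro tendsto_eventually) (auto simp: eventually_sequentially)
    show "real (N_int (real q) \<epsilon> d) \<ge> C ^ d * (1 + r d)" for d
    \<comment> \<open>In the other case \<open>r d = -1\<close> and the claim is just that
      \<open>N_int\<close> is nonnegative.\<close>
    proof (cases "1 \<le> (1 - \<epsilon>) * C ^ d")
      case True
      then have "C ^ d * 1 \<le> C ^ d * ((1 - \<epsilon>) * C ^ d)"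
        using C(1) by (intro mult_left_mono) auto
      also have "\<dots> = (1 - \<epsilon>) * (1 / \<theta>) ^ d"
        by (simp add: power_mult_distrib flip: C(2))
      also have "\<dots> \<le> real (N_int (real q) \<epsilon> d)"
        by (rule N_int_ge[OF \<epsilon>(1)])
      finally show ?thesis using True by (simp add: r_def)
    qed (simp add: r_def)
  qed
  with C(1) show ?thesis by blast
qed

end
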